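(* Let $\mathcal{A}$ be a semi-abelian category satisfying the Smith is Huq condition (SH), and let $\xi^M_N\colon M\flat N\to N$ and $\xi^N_M\colon N\flat M\to M$ be internal actions in $\mathcal{A}$. Let $q\colon M+N\to M\bowtie N$ be the Peiffer product of these actions, and let $\sigma_{\xi^N_M}\colon M+N\to M\rtimes N$ and $\sigma_{\xi^M_N}\colon M+N\to N\rtimes M$ be the canonical quotients onto the semi-direct products. Then there are regular epimorphisms $q_{M\rtimes N}\colon M\rtimes N\to M\bowtie N$ and $q_{N\rtimes M}\colon N\rtimes M\to M\bowtie N$ with $$q_{M\rtimes N}\circ\sigma_{\xi^N_M}=q=q_{N\rtimes M}\circ\sigma_{\xi^M_N},$$ and the resulting commutative square exhibits $M\bowtie N$ as the pushout of $\sigma_{\xi^N_M}$ and $\sigma_{\xi^M_N}$.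
   Context: A semi-abelian category is a pointed, Barr exact, Bourn protomodular category with binary coproducts. (SH): two internal equivalence relations on the same object centralise each other in the Smith–Pedicchio sense as soon as their normalisations (the corresponding normal subobjects) commute in the sense of Huq. Notation: $+$ is the coproduct (with $A+B$ and $B+A$ identified), $i_A\colon A\to A+B$ and $i_B\colon B\to A+B$ are the inclusions, $[f,g]\colon A+B\to C$ is the morphism induced by $f\colon A\to C$, $g\colon B\to C$. The functor $\flat$: $k_{A,B}\colon A\flat B\to A+B$ is the kernel of $[1_A,0]\colon A+B\to A$; for $f\colon A\to A'$, $g\colon B\to B'$, $f\flat g$ is the restriction of $f+g$ to kernels. For fixed $A$, $A\flat(-)$ is a monad with unit $\eta^A_B\colon B\to A\flat B$ determined by $k_{A,B}\circ\eta^A_B=i_B$ and multiplication $\mu^A_B\colon A\flat(A\flat B)\to A\flat B$ determined by $k_{A,B}\circ\mu^A_B=[i_A,k_{A,B}]\circ k_{A,A\flat B}$. An internal action of $A$ on $X$ is a morphism $\xi\colon A\flat X\to X$ making $X$ an algebra for this monad. Semi-direct product: for an action $\xi\colon A\flat X\to X$, $\sigma_\xi\colon A+X\to X\rtimes_\xi A$ is the coequaliser of $i_X\circ\xi$ and $k_{A,X}\colon A\flat X\to A+X$. Here $M\rtimes N=M\rtimes_{\xi^N_M}N$ and $N\rtimes M=N\rtimes_{\xi^M_N}M$. Peiffer product: $q\colon M+N\to M\bowtie N$ is the coequaliser of the two morphisms $[k_{N,M},k_{M,N}]$ and $\xi^N_M+\xi^M_N$ from $(N\flat M)+(M\flat N)$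 to $M+N$. *)

theory Defs
  imports Main
begin

section \<open>Categories\<close>

record ('o, 'm) cat =
  Obj :: "'o set"
  Arr :: "'m set"
  Dom :: "'m \<Rightarrow> 'o"
  Cod :: "'m \<Rightarrow> 'o"
  Ident :: "'o \<Rightarrow> 'm"
  Comp :: "'m \<Rightarrow> 'm \<Rightarrow> 'm"  (infixr "\<cdot>\<index>" 70)

text \<open>Composition is in the usual order: in \<open>g \<cdot>\<^bsub>C\<^esub> f\<close> the arrow \<open>f\<close> comes first. The fields
  are only meaningful on objects, arrows and composable pairs.\<close>

definition hom :: "('o, 'm, 'z) cat_scheme \<Rightarrow> 'o \<Rightarrow> 'o \<Rightarrow> 'm set" where
  "hom C A B = {f \<in> Arr C. Dom C f = A \<and> Cod C f = B}"

locale category =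
  fixes C :: "('o, 'm, 'z) cat_scheme" (structure)
  assumes dom_in_Obj: "f \<in> Arr C \<Longrightarrow> Dom C f \<in> Obj C"
    and cod_in_Obj: "f \<in> Arr C \<Longrightarrow> Cod C f \<in> Obj C"
    and ident_in_hom: "A \<in> Obj C \<Longrightarrow> Ident C A \<in> hom C A A"
    and comp_in_hom: "\<lbrakk>f \<in> hom C X Y; g \<in> hom C Y Z\<rbrakk> \<Longrightarrow> g \<cdot> f \<in> hom C X Z"
    and comp_ident_left: "f \<in> hom C X Y \<Longrightarrow> Ident C Y \<cdot> f = f"
    and comp_ident_right: "f \<in> hom C X Y \<Longrightarrow> f \<cdot> Ident C X = f"
    and comp_assoc: "\<lbrakk>f \<in> hom C W X; g \<in> hom C X Y; h \<in> hom C Y Z\<rbrakk>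
      \<Longrightarrow> (h \<cdot> g) \<cdot> f = h \<cdot> (g \<cdot> f)"

definition is_iso :: "('o, 'm, 'z) cat_scheme \<Rightarrow> 'm \<Rightarrow> bool" where
  "is_iso C f \<longleftrightarrow> f \<in> Arr C \<and>
    (\<exists>g \<in> hom C (Cod C f) (Dom C f).
      g \<cdot>\<^bsub>C\<^esub> f = Ident C (Dom C f) \<and> f \<cdot>\<^bsub>C\<^esub> g = Ident C (Cod C f))"


section \<open>Limits and colimits\<close>

definition is_terminal :: "('o, 'm, 'z) cat_scheme \<Rightarrow> 'o \<Rightarrow> bool" where
  "is_terminal C Z \<longleftrightarrow> Z \<in> Obj C \<and> (\<forall>A \<in> Obj C. \<exists>!f. f \<in> hom C A Z)"

definition is_initial :: "('o, 'm, 'z) cat_scheme \<Rightarrow> 'o \<Rightarrow> bool" where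
  "is_initial C Z \<longleftrightarrow> Z \<in> Obj C \<and> (\<forall>A \<in> Obj C. \<exists>!f. f \<in> hom C Z A)"

definition is_zero_object :: "('o, 'm, 'z) cat_scheme \<Rightarrow> 'o \<Rightarrow> bool" where
  "is_zero_object C Z \<longleftrightarrow> is_initial C Z \<and> is_terminal C Z"

definition is_product :: "('o, 'm, 'z) cat_scheme \<Rightarrow> 'm \<Rightarrow> 'm \<Rightarrow> bool" where
  "is_product C p q \<longleftrightarrow> p \<in> Arr C \<and> q \<in> Arr C \<and> Dom C p = Dom C q \<and>
    (\<forall>T \<in> Obj C. \<forall>f \<in> hom C T (Cod C p). \<forall>g \<in> hom C T (Cod C q).
      \<exists>!h. h \<in> hom C T (Dom C p) \<and> p \<cdot>\<^bsub>C\<^esub> h = f \<and> q \<cdot>\<^bsub>C\<^esub> h = g)"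

definition is_coproduct :: "('o, 'm, 'z) cat_scheme \<Rightarrow> 'm \<Rightarrow> 'm \<Rightarrow> bool" where
  "is_coproduct C i j \<longleftrightarrow> i \<in> Arr C \<and> j \<in> Arr C \<and> Cod C i = Cod C j \<and>
    (\<forall>T \<in> Obj C. \<forall>f \<in> hom C (Dom C i) T. \<forall>g \<in> hom C (Dom C j) T.
      \<exists>!h. h \<in> hom C (Cod C i) T \<and> h \<cdot>\<^bsub>C\<^esub> i = f \<and> h \<cdot>\<^bsub>C\<^esub> j = g)"

text \<open>\<open>is_pullback C f g p q\<close>: the square \<open>f p = g q\<close> is a pullback.
  \<open>is_pushout C f g p q\<close>: the square \<open>p f = q g\<close> is a pushout.\<close>

definition is_pullback :: "('o, 'm, 'z) cat_scheme \<Rightarrow> 'm \<Rightarrow> 'm \<Rightarrow> 'm \<Rightarrow> 'm \<Rightarrow> bool" where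
  "is_pullback C f g p q \<longleftrightarrow>
    f \<in> Arr C \<and> g \<in> Arr C \<and> p \<in> Arr C \<and> q \<in> Arr C \<and>
    Cod C f = Cod C g \<and> Dom C p = Dom C q \<and> Cod C p = Dom C f \<and> Cod C q = Dom C g \<and>
    f \<cdot>\<^bsub>C\<^esub> p = g \<cdot>\<^bsub>C\<^esub> q \<and>
    (\<forall>T \<in> Obj C. \<forall>a \<in> hom C T (Dom C f). \<forall>b \<in> hom C T (Dom C g).
      f \<cdot>\<^bsub>C\<^esub> a = g \<cdot>\<^bsub>C\<^esub> b \<longrightarrow>
      (\<exists>!h. h \<in> hom C T (Dom C p) \<and> p \<cdot>\<^bsub>C\<^esub> h = a \<and> q \<cdot>\<^bsub>C\<^esub> h = b))"

definition is_pushout :: "('o, 'm, 'z) cat_scheme \<Rightarrow> 'm \<Rightarrow> 'm \<Rightarrow> 'm \<Rightarrow> 'm \<Rightarrow> bool" where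
  "is_pushout C f g p q \<longleftrightarrow>
    f \<in> Arr C \<and> g \<in> Arr C \<and> p \<in> Arr C \<and> q \<in> Arr C \<and>
    Dom C f = Dom C g \<and> Cod C p = Cod C q \<and> Dom C p = Cod C f \<and> Dom C q = Cod C g \<and>
    p \<cdot>\<^bsub>C\<^esub> f = q \<cdot>\<^bsub>C\<^esub> g \<and>
    (\<forall>T \<in> Obj C. \<forall>a \<in> hom C (Cod C f) T. \<forall>b \<in> hom C (Cod C g) T.
      a \<cdot>\<^bsub>C\<^esub> f = b \<cdot>\<^bsub>C\<^esub> g \<longrightarrow>
      (\<exists>!h. h \<in> hom C (Cod C p) T \<and> h \<cdot>\<^bsub>C\<^esub> p = a \<and> h \<cdot>\<^bsub>C\<^esub> q = b))"

definition is_coequaliser :: "('o, 'm, 'z) cat_scheme \<Rightarrow> 'm \<Rightarrow> 'm \<Rightarrow> 'm \<Rightarrow> bool" where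
  "is_coequaliser C f g e \<longleftrightarrow>
    f \<in> Arr C \<and> g \<in> Arr C \<and> e \<in> Arr C \<and>
    Dom C f = Dom C g \<and> Cod C f = Cod C g \<and> Dom C e = Cod C f \<and>
    e \<cdot>\<^bsub>C\<^esub> f = e \<cdot>\<^bsub>C\<^esub> g \<and>
    (\<forall>T \<in> Obj C. \<forall>t \<in> hom C (Cod C f) T. t \<cdot>\<^bsub>C\<^esub> f = t \<cdot>\<^bsub>C\<^esub> g \<longrightarrow>
      (\<exists>!h. h \<in> hom C (Cod C e) T \<and> h \<cdot>\<^bsub>C\<^esub> e = t))"

definition regular_epi :: "('o, 'm, 'z) cat_scheme \<Rightarrow> 'm \<Rightarrow> bool" where
  "regular_epi C e \<longleftrightarrow> (\<exists>f g. is_coequaliser C f g e)"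

text \<open>In a pointed category there is exactly one arrow as described below; elsewhere \<open>zero_arr\<close>
  and \<open>is_kernel\<close> are not used.\<close>

definition zero_arr :: "('o, 'm, 'z) cat_scheme \<Rightarrow> 'o \<Rightarrow> 'o \<Rightarrow> 'm" where
  "zero_arr C A B = (THE f. \<exists>Z u v. is_zero_object C Z \<and>
    u \<in> hom C A Z \<and> v \<in> hom C Z B \<and> f = v \<cdot>\<^bsub>C\<^esub> u)"

definition is_kernel :: "('o, 'm, 'z) cat_scheme \<Rightarrow> 'm \<Rightarrow> 'm \<Rightarrow> bool" where
  "is_kernel C k f \<longleftrightarrow> k \<in> Arr C \<and> f \<in> Arr C \<and> Cod C k = Dom C f \<and>
    f \<cdot>\<^bsub>C\<^esub> k = zero_arr C (Dom C k) (Cod C f) \<and>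
    (\<forall>T \<in> Obj C. \<forall>t \<in> hom C T (Dom C f). f \<cdot>\<^bsub>C\<^esub> t = zero_arr C T (Cod C f) \<longrightarrow>
      (\<exists>!h. h \<in> hom C T (Dom C k) \<and> k \<cdot>\<^bsub>C\<^esub> h = t))"


section \<open>Semi-abelian categories\<close>

text \<open>An internal equivalence relation on \<open>X\<close>, given by its two projections
  \<open>r\<^sub>1, r\<^sub>2 : R \<rightarrow> X\<close>.\<close>

definition is_equivalence_relation ::
  "('o, 'm, 'z) cat_scheme \<Rightarrow> 'o \<Rightarrow> 'm \<Rightarrow> 'm \<Rightarrow> bool" where
  "is_equivalence_relation C X r\<^sub>1 r\<^sub>2 \<longleftrightarrow> (\<exists>R \<in> Obj C.
    r\<^sub>1 \<in> hom C R X \<and> r\<^sub>2 \<in> hom C R X \<and>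
    \<comment> \<open>jointly monic\<close>
    (\<forall>T \<in> Obj C. \<forall>a \<in> hom C T R. \<forall>b \<in> hom C T R.
      r\<^sub>1 \<cdot>\<^bsub>C\<^esub> a = r\<^sub>1 \<cdot>\<^bsub>C\<^esub> b \<and> r\<^sub>2 \<cdot>\<^bsub>C\<^esub> a = r\<^sub>2 \<cdot>\<^bsub>C\<^esub> b \<longrightarrow> a = b) \<and>
    \<comment> \<open>reflexive\<close>
    (\<exists>e \<in> hom C X R. r\<^sub>1 \<cdot>\<^bsub>C\<^esub> e = Ident C X \<and> r\<^sub>2 \<cdot>\<^bsub>C\<^esub> e = Ident C X) \<and>
    \<comment> \<open>symmetric\<close>
    (\<exists>s \<in> hom C R R. r\<^sub>1 \<cdot>\<^bsub>C\<^esub> s = r\<^sub>2 \<and> r\<^sub>2 \<cdot>\<^bsub>C\<^esub> s = r\<^sub>1) \<and>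
    \<comment> \<open>transitive\<close>
    (\<forall>p q. is_pullback C r\<^sub>2 r\<^sub>1 p q \<longrightarrow>
      (\<exists>t \<in> hom C (Dom C p) R. r\<^sub>1 \<cdot>\<^bsub>C\<^esub> t = r\<^sub>1 \<cdot>\<^bsub>C\<^esub> p \<and> r\<^sub>2 \<cdot>\<^bsub>C\<^esub> t = r\<^sub>2 \<cdot>\<^bsub>C\<^esub> q)))"

locale pointed_category = category +
  assumes ex_zero_object: "\<exists>Z. is_zero_object C Z"

locale finitely_complete_category = category +
  assumes ex_terminal: "\<exists>Z. is_terminal C Z"
    and ex_pullback: "\<lbrakk>f \<in> hom C X Z; g \<in> hom C Y Z\<rbrakk> \<Longrightarrow> \<exists>p q. is_pullback C f g p q"

locale regular_category = finitely_complete_category +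
  assumes ex_coequaliser_kernel_pair:
      "is_pullback C f f p q \<Longrightarrow> \<exists>e. is_coequaliser C p q e"
    and regular_epi_stable:
      "\<lbrakk>regular_epi C f; is_pullback C f g p q\<rbrakk> \<Longrightarrow> regular_epi C q"

locale barr_exact_category = regular_category +
  assumes equivalence_relation_effective:
    "is_equivalence_relation C X r\<^sub>1 r\<^sub>2 \<Longrightarrow> \<exists>f. is_pullback C f f r\<^sub>1 r\<^sub>2"

text \<open>Bourn protomodularity: for every \<open>v : E \<rightarrow> B\<close> the change-of-base functor from points
  (split epimorphisms with a chosen section) over \<open>B\<close> to points over \<open>E\<close> reflects isomorphisms.
  Here \<open>f\<close> is a morphism of points from \<open>(p, s)\<close> to \<open>(p', s')\<close>, and \<open>h\<close> is its image under
  pulling back along \<open>v\<close>.\<close>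

locale protomodular_category = finitely_complete_category +
  assumes change_of_base_conservative:
    "\<lbrakk>v \<in> hom C E B;
      p \<in> hom C A B; s \<in> hom C B A; p \<cdot> s = Ident C B;
      p' \<in> hom C A' B; s' \<in> hom C B A'; p' \<cdot> s' = Ident C B;
      f \<in> hom C A A'; p' \<cdot> f = p; f \<cdot> s = s';
      is_pullback C v p a b; is_pullback C v p' a' b';
      h \<in> hom C (Dom C a) (Dom C a'); a' \<cdot> h = a; b' \<cdot> h = f \<cdot> b;
      is_iso C h\<rbrakk> \<Longrightarrow> is_iso C f"

locale semi_abelian_category =
  pointed_category + barr_exact_category + protomodular_category +
  assumes ex_coproduct: "\<lbrakk>A \<in> Obj C; B \<in> Obj C\<rbrakk>
    \<Longrightarrow> \<exists>i j. is_coproduct C i j \<and> Dom C i = A \<and> Dom C j = B"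


section \<open>The Smith is Huq condition\<close>

text \<open>\<open>m : A \<rightarrow> X\<close> and \<open>n : B \<rightarrow> X\<close> commute when some \<open>\<phi> : A \<times> B \<rightarrow> X\<close> satisfies
  \<open>\<phi> \<langle>1, 0\<rangle> = m\<close> and \<open>\<phi> \<langle>0, 1\<rangle> = n\<close>; below \<open>l\<close> and \<open>r\<close> are these two inclusions.\<close>

definition huq_commute :: "('o, 'm, 'z) cat_scheme \<Rightarrow> 'm \<Rightarrow> 'm \<Rightarrow> bool" where
  "huq_commute C m n \<longleftrightarrow> m \<in> Arr C \<and> n \<in> Arr C \<and> Cod C m = Cod C n \<and>
    (\<exists>p q l r \<phi>. is_product C p q \<and> Cod C p = Dom C m \<and> Cod C q = Dom C n \<and>
      l \<in> hom C (Dom C m) (Dom C p) \<and>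
      p \<cdot>\<^bsub>C\<^esub> l = Ident C (Dom C m) \<and> q \<cdot>\<^bsub>C\<^esub> l = zero_arr C (Dom C m) (Dom C n) \<and>
      r \<in> hom C (Dom C n) (Dom C p) \<and>
      p \<cdot>\<^bsub>C\<^esub> r = zero_arr C (Dom C n) (Dom C m) \<and> q \<cdot>\<^bsub>C\<^esub> r = Ident C (Dom C n) \<and>
      \<phi> \<in> hom C (Dom C p) (Cod C m) \<and> \<phi> \<cdot>\<^bsub>C\<^esub> l = m \<and> \<phi> \<cdot>\<^bsub>C\<^esub> r = n)"

definition is_normalisation :: "('o, 'm, 'z) cat_scheme \<Rightarrow> 'm \<Rightarrow> 'm \<Rightarrow> 'm \<Rightarrow> bool" where
  "is_normalisation C r\<^sub>1 r\<^sub>2 n \<longleftrightarrow> (\<exists>k. is_kernel C k r\<^sub>1 \<and> n = r\<^sub>2 \<cdot>\<^bsub>C\<^esub> k)"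

text \<open>\<open>R\<close> and \<open>S\<close> centralise each other when there is a double equivalence relation \<open>D\<close> on them,
  with projections \<open>p\<^sub>1, p\<^sub>2 : D \<rightarrow> R\<close> and \<open>q\<^sub>1, q\<^sub>2 : D \<rightarrow> S\<close>, which is centralising: the square
  \<open>r\<^sub>1 p\<^sub>1 = s\<^sub>1 q\<^sub>1\<close> is a pullback. By symmetry of the relations the other three squares
  \<open>r\<^sub>j p\<^sub>i = s\<^sub>i q\<^sub>j\<close> are then pullbacks as well. In elements, \<open>D\<close> consists of the
  squares with rows \<open>x R y\<close>, \<open>u R v\<close> (its images under \<open>p\<^sub>1\<close>, \<open>p\<^sub>2\<close>) and columns \<open>x S u\<close>,
  \<open>y S v\<close> (its images under \<open>q\<^sub>1\<close>, \<open>q\<^sub>2\<close>) that belong to the double relation; the pullback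
  condition says that \<open>v\<close> exists uniquely given \<open>y R x S u\<close>.\<close>

definition smith_pedicchio_centralise ::
  "('o, 'm, 'z) cat_scheme \<Rightarrow> 'm \<Rightarrow> 'm \<Rightarrow> 'm \<Rightarrow> 'm \<Rightarrow> bool" where
  "smith_pedicchio_centralise C r\<^sub>1 r\<^sub>2 s\<^sub>1 s\<^sub>2 \<longleftrightarrow> (\<exists>p\<^sub>1 p\<^sub>2 q\<^sub>1 q\<^sub>2.
    is_equivalence_relation C (Dom C r\<^sub>1) p\<^sub>1 p\<^sub>2 \<and>
    is_equivalence_relation C (Dom C s\<^sub>1) q\<^sub>1 q\<^sub>2 \<and>
    Dom C p\<^sub>1 = Dom C q\<^sub>1 \<and>
    r\<^sub>1 \<cdot>\<^bsub>C\<^esub> p\<^sub>1 = s\<^sub>1 \<cdot>\<^bsub>C\<^esub> q\<^sub>1 \<and> r\<^sub>2 \<cdot>\<^bsub>C\<^esub> p\<^sub>1 = s\<^sub>1 \<cdot>\<^bsub>C\<^esub> q\<^sub>2 \<and>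
    r\<^sub>1 \<cdot>\<^bsub>C\<^esub> p\<^sub>2 = s\<^sub>2 \<cdot>\<^bsub>C\<^esub> q\<^sub>1 \<and> r\<^sub>2 \<cdot>\<^bsub>C\<^esub> p\<^sub>2 = s\<^sub>2 \<cdot>\<^bsub>C\<^esub> q\<^sub>2 \<and>
    is_pullback C r\<^sub>1 s\<^sub>1 p\<^sub>1 q\<^sub>1)"

definition smith_is_huq :: "('o, 'm, 'z) cat_scheme \<Rightarrow> bool" where
  "smith_is_huq C \<longleftrightarrow> (\<forall>X r\<^sub>1 r\<^sub>2 s\<^sub>1 s\<^sub>2 m n.
    is_equivalence_relation C X r\<^sub>1 r\<^sub>2 \<and> is_equivalence_relation C X s\<^sub>1 s\<^sub>2 \<and>
    is_normalisation C r\<^sub>1 r\<^sub>2 m \<and> is_normalisation C s\<^sub>1 s\<^sub>2 n \<and> huq_commute C m n \<longrightarrow>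
    smith_pedicchio_centralise C r\<^sub>1 r\<^sub>2 s\<^sub>1 s\<^sub>2)"


section \<open>Internal actions, semi-direct products and the Peiffer product\<close>

text \<open>The functor \<open>\<flat>\<close> depends on a choice of binary coproducts and of kernels. The record adds
  such a choice to a category; nothing is assumed about it besides the universal properties.
  The object \<open>A + B\<close> is the common codomain of \<open>inc1 C A B : A \<rightarrow> A + B\<close> and
  \<open>inc2 C A B : B \<rightarrow> A + B\<close>.\<close>

record ('o, 'm) chosen_cat = "('o, 'm) cat" +
  inc1 :: "'o \<Rightarrow> 'o \<Rightarrow> 'm"
  inc2 :: "'o \<Rightarrow> 'o \<Rightarrow> 'm"
  ker :: "'m \<Rightarrow> 'm"

definition chosen_coproducts_kernels :: "('o, 'm, 'z) chosen_cat_scheme \<Rightarrow> bool" where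
  "chosen_coproducts_kernels C \<longleftrightarrow>
    (\<forall>A \<in> Obj C. \<forall>B \<in> Obj C. is_coproduct C (inc1 C A B) (inc2 C A B) \<and>
      Dom C (inc1 C A B) = A \<and> Dom C (inc2 C A B) = B) \<and>
    (\<forall>f \<in> Arr C. is_kernel C (ker C f) f)"

definition coprod :: "('o, 'm, 'z) chosen_cat_scheme \<Rightarrow> 'o \<Rightarrow> 'o \<Rightarrow> 'o" where
  "coprod C A B = Cod C (inc1 C A B)"

text \<open>\<open>copair C f g\<close> is \<open>[f, g] : A + B \<rightarrow> X\<close> for \<open>f : A \<rightarrow> X\<close>, \<open>g : B \<rightarrow> X\<close>.\<close>

definition copair :: "('o, 'm, 'z) chosen_cat_scheme \<Rightarrow> 'm \<Rightarrow> 'm \<Rightarrow> 'm" where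
  "copair C f g = (THE h. h \<in> hom C (coprod C (Dom C f) (Dom C g)) (Cod C f) \<and>
    h \<cdot>\<^bsub>C\<^esub> inc1 C (Dom C f) (Dom C g) = f \<and> h \<cdot>\<^bsub>C\<^esub> inc2 C (Dom C f) (Dom C g) = g)"

definition coprod_map :: "('o, 'm, 'z) chosen_cat_scheme \<Rightarrow> 'm \<Rightarrow> 'm \<Rightarrow> 'm" where
  "coprod_map C f g = copair C
    (inc1 C (Cod C f) (Cod C g) \<cdot>\<^bsub>C\<^esub> f) (inc2 C (Cod C f) (Cod C g) \<cdot>\<^bsub>C\<^esub> g)"

text \<open>The canonical isomorphism \<open>A + B \<rightarrow> B + A\<close>. It makes the identification of \<open>A + B\<close> with
  \<open>B + A\<close> explicit; a strict equality of the chosen coproducts would force both inclusions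
  \<open>A \<rightarrow> A + A\<close> to coincide.\<close>

definition twist :: "('o, 'm, 'z) chosen_cat_scheme \<Rightarrow> 'o \<Rightarrow> 'o \<Rightarrow> 'm" where
  "twist C A B = copair C (inc2 C B A) (inc1 C B A)"

definition factor_through :: "('o, 'm, 'z) cat_scheme \<Rightarrow> 'm \<Rightarrow> 'm \<Rightarrow> 'm" where
  "factor_through C k f = (THE h. h \<in> hom C (Dom C f) (Dom C k) \<and> k \<cdot>\<^bsub>C\<^esub> h = f)"

text \<open>\<open>flat_ker C A B\<close> is \<open>k\<^bsub>A,B\<^esub> : A \<flat> B \<rightarrow> A + B\<close> and \<open>flat C A B\<close> is the object \<open>A \<flat> B\<close>.\<close>

definition flat_ker :: "('o, 'm, 'z) chosen_cat_scheme \<Rightarrow> 'o \<Rightarrow> 'o \<Rightarrow> 'm" where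
  "flat_ker C A B = ker C (copair C (Ident C A) (zero_arr C B A))"

definition flat :: "('o, 'm, 'z) chosen_cat_scheme \<Rightarrow> 'o \<Rightarrow> 'o \<Rightarrow> 'o" where
  "flat C A B = Dom C (flat_ker C A B)"

definition flat_map :: "('o, 'm, 'z) chosen_cat_scheme \<Rightarrow> 'm \<Rightarrow> 'm \<Rightarrow> 'm" where
  "flat_map C f g = factor_through C (flat_ker C (Cod C f) (Cod C g))
    (coprod_map C f g \<cdot>\<^bsub>C\<^esub> flat_ker C (Dom C f) (Dom C g))"

definition flat_unit :: "('o, 'm, 'z) chosen_cat_scheme \<Rightarrow> 'o \<Rightarrow> 'o \<Rightarrow> 'm" where
  "flat_unit C A B = factor_through C (flat_ker C A B) (inc2 C A B)"

definition flat_mult :: "('o, 'm, 'z) chosen_cat_scheme \<Rightarrow> 'o \<Rightarrow> 'o \<Rightarrow> 'm" where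
  "flat_mult C A B = factor_through C (flat_ker C A B)
    (copair C (inc1 C A B) (flat_ker C A B) \<cdot>\<^bsub>C\<^esub> flat_ker C A (flat C A B))"

definition internal_action ::
  "('o, 'm, 'z) chosen_cat_scheme \<Rightarrow> 'o \<Rightarrow> 'o \<Rightarrow> 'm \<Rightarrow> bool" where
  "internal_action C A X \<xi> \<longleftrightarrow> A \<in> Obj C \<and> X \<in> Obj C \<and> \<xi> \<in> hom C (flat C A X) X \<and>
    \<xi> \<cdot>\<^bsub>C\<^esub> flat_unit C A X = Ident C X \<and>
    \<xi> \<cdot>\<^bsub>C\<^esub> flat_mult C A X = \<xi> \<cdot>\<^bsub>C\<^esub> flat_map C (Ident C A) \<xi>"

text \<open>Semi-direct and Peiffer products are colimits, determined up to isomorphism; the predicates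
  say that an arrow is the quotient map onto one. The objects \<open>X \<rtimes>\<^bsub>\<xi>\<^esub> A\<close> and \<open>M \<bowtie> N\<close> are the
  codomains of these arrows.\<close>

definition is_semidirect_quotient ::
  "('o, 'm, 'z) chosen_cat_scheme \<Rightarrow> 'o \<Rightarrow> 'o \<Rightarrow> 'm \<Rightarrow> 'm \<Rightarrow> bool" where
  "is_semidirect_quotient C A X \<xi> \<sigma> \<longleftrightarrow>
    is_coequaliser C (inc2 C A X \<cdot>\<^bsub>C\<^esub> \<xi>) (flat_ker C A X) \<sigma>"

text \<open>Here \<open>\<alpha> : M \<flat> N \<rightarrow> N\<close> and \<open>\<beta> : N \<flat> M \<rightarrow> M\<close>. The kernel \<open>N \<flat> M \<rightarrow> N + M\<close> is
  regarded as an arrow into \<open>M + N\<close> by means of \<open>twist\<close>.\<close>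

definition is_peiffer_quotient ::
  "('o, 'm, 'z) chosen_cat_scheme \<Rightarrow> 'o \<Rightarrow> 'o \<Rightarrow> 'm \<Rightarrow> 'm \<Rightarrow> 'm \<Rightarrow> bool" where
  "is_peiffer_quotient C M N \<alpha> \<beta> q \<longleftrightarrow>
    is_coequaliser C
      (copair C (twist C N M \<cdot>\<^bsub>C\<^esub> flat_ker C N M) (flat_ker C M N))
      (coprod_map C \<beta> \<alpha>) q"

end

theory Submission
  imports Defs
begin

text \<open>A morphism out of \<open>M + N\<close> coequalises the pair defining the Peiffer product exactly when it
  coequalises both pairs defining the semi-direct products, so \<open>M \<bowtie> N\<close> is a joint coequaliser of
  these two pairs. Taking the joint coequaliser in two steps shows that it is the pushout of
  the two individual coequalisers, and that each leg of the pushout is again a coequaliser, namely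
  of the other pair pushed forward.\<close>

section \<open>Joint coequalisers of two parallel pairs\<close>

definition is_joint_coequaliser ::
  "('o, 'm, 'z) cat_scheme \<Rightarrow> 'm \<Rightarrow> 'm \<Rightarrow> 'm \<Rightarrow> 'm \<Rightarrow> 'm \<Rightarrow> bool" where
  "is_joint_coequaliser C f\<^sub>1 g\<^sub>1 f\<^sub>2 g\<^sub>2 q \<longleftrightarrow> q \<in> Arr C \<and> Dom C q = Cod C f\<^sub>1 \<and>
    q \<cdot>\<^bsub>C\<^esub> f\<^sub>1 = q \<cdot>\<^bsub>C\<^esub> g\<^sub>1 \<and> q \<cdot>\<^bsub>C\<^esub> f\<^sub>2 = q \<cdot>\<^bsub>C\<^esub> g\<^sub>2 \<and>
    (\<forall>T \<in> Obj C. \<forall>t \<in> hom C (Cod C f\<^sub>1) T.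
      t \<cdot>\<^bsub>C\<^esub> f\<^sub>1 = t \<cdot>\<^bsub>C\<^esub> g\<^sub>1 \<and> t \<cdot>\<^bsub>C\<^esub> f\<^sub>2 = t \<cdot>\<^bsub>C\<^esub> g\<^sub>2 \<longrightarrow>
      (\<exists>!h. h \<in> hom C (Cod C q) T \<and> h \<cdot>\<^bsub>C\<^esub> q = t))"

text \<open>The definition treats the two pairs alike except that it types \<open>q\<close> and the
  test arrows by the codomain of the first pair only. Agreement of the codomains restores the
  symmetry.\<close>

lemma is_joint_coequaliser_swap:
  assumes "is_joint_coequaliser C f\<^sub>1 g\<^sub>1 f\<^sub>2 g\<^sub>2 q" "Cod C f\<^sub>1 = Cod C f\<^sub>2"
  shows "is_joint_coequaliser C f\<^sub>2 g\<^sub>2 f\<^sub>1 g\<^sub>1 q"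
  using assms unfolding is_joint_coequaliser_def by auto

lemma in_homD:
  assumes "f \<in> hom C A B"
  shows "f \<in> Arr C" "Dom C f = A" "Cod C f = B"
  using assms by (simp_all add: hom_def)

text \<open>Both \<open>a\<close> and \<open>b\<close> are factorisations through \<open>e\<close>
  of the single arrow \<open>a \<cdot> e\<close>, which coequalises \<open>f\<close> and
  \<open>g\<close> because \<open>e\<close> does. Uniqueness of such a factorisation identifies
  them.\<close>

lemma coequaliser_epi:
  assumes "is_coequaliser C f g e" "category C"
    and "a \<in> hom C (Cod C e) T" "b \<in> hom C (Cod C e) T" "a \<cdot>\<^bsub>C\<^esub> e = b \<cdot>\<^bsub>C\<^esub> e"
  shows "a = b"
proof -
  interpret category C by fact
  from assms(1) have f: "f \<in> hom C (Dom C f) (Cod C f)" and g: "g \<in> hom C (Dom C f) (Cod C f)"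
    and e: "e \<in> hom C (Cod C f) (Cod C e)" and eq: "e \<cdot>\<^bsub>C\<^esub> f = e \<cdot>\<^bsub>C\<^esub> g"
    and univ: "\<And>T t. \<lbrakk>T \<in> Obj C; t \<in> hom C (Cod C f) T; t \<cdot>\<^bsub>C\<^esub> f = t \<cdot>\<^bsub>C\<^esub> g\<rbrakk>
      \<Longrightarrow> \<exists>!h. h \<in> hom C (Cod C e) T \<and> h \<cdot>\<^bsub>C\<^esub> e = t"
    by (simp_all add: is_coequaliser_def hom_def)
  have "(a \<cdot>\<^bsub>C\<^esub> e) \<cdot>\<^bsub>C\<^esub> f = (a \<cdot>\<^bsub>C\<^esub> e) \<cdot>\<^bsub>C\<^esub> g"
    using comp_assoc[OF f e assms(3)] comp_assoc[OF g e assms(3)] eq by simp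
  moreover have "T \<in> Obj C" using cod_in_Obj in_homD[OF assms(3)] by blast
  ultimately show ?thesis
    using univ[OF _ comp_in_hom[OF e assms(3)]] assms(3-5) by metis
qed

text \<open>This is coequalising in two steps. Since \<open>q\<close> coequalises the first pair, it
  factors through \<open>s\<close>. What remains to be coequalised on \<open>Cod C s\<close> is the
  second pair pushed forward along \<open>s\<close>, and the factor \<open>r\<close> does this
  universally.\<close>

lemma joint_coequaliser_factor:
  assumes "category C" and coeq: "is_coequaliser C f\<^sub>1 g\<^sub>1 s"
    and f\<^sub>2: "f\<^sub>2 \<in> hom C B (Cod C f\<^sub>1)" and g\<^sub>2: "g\<^sub>2 \<in> hom C B (Cod C f\<^sub>1)"
    and q: "is_joint_coequaliser C f\<^sub>1 g\<^sub>1 f\<^sub>2 g\<^sub>2 q"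
  obtains r where "r \<in> hom C (Cod C s) (Cod C q)" "r \<cdot>\<^bsub>C\<^esub> s = q"
    "is_coequaliser C (s \<cdot>\<^bsub>C\<^esub> f\<^sub>2) (s \<cdot>\<^bsub>C\<^esub> g\<^sub>2) r"
proof -
  interpret category C by fact
  let ?X = "Cod C f\<^sub>1"
  from coeq have f\<^sub>1: "f\<^sub>1 \<in> hom C (Dom C f\<^sub>1) ?X" and g\<^sub>1: "g\<^sub>1 \<in> hom C (Dom C f\<^sub>1) ?X"
    and s: "s \<in> hom C ?X (Cod C s)" and s_eq: "s \<cdot>\<^bsub>C\<^esub> f\<^sub>1 = s \<cdot>\<^bsub>C\<^esub> g\<^sub>1"
    and s_univ: "\<And>T t. \<lbrakk>T \<in> Obj C; t \<in> hom C ?X T; t \<cdot>\<^bsub>C\<^esub> f\<^sub>1 = t \<cdot>\<^bsub>C\<^esub> g\<^sub>1\<rbrakk>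
      \<Longrightarrow> \<exists>!h. h \<in> hom C (Cod C s) T \<and> h \<cdot>\<^bsub>C\<^esub> s = t"
    by (simp_all add: is_coequaliser_def hom_def)
  from q have q_hom: "q \<in> hom C ?X (Cod C q)"
    and q_eq: "q \<cdot>\<^bsub>C\<^esub> f\<^sub>1 = q \<cdot>\<^bsub>C\<^esub> g\<^sub>1" "q \<cdot>\<^bsub>C\<^esub> f\<^sub>2 = q \<cdot>\<^bsub>C\<^esub> g\<^sub>2"
    and q_univ: "\<And>T t. \<lbrakk>T \<in> Obj C; t \<in> hom C ?X T; t \<cdot>\<^bsub>C\<^esub> f\<^sub>1 = t \<cdot>\<^bsub>C\<^esub> g\<^sub>1; t \<cdot>\<^bsub>C\<^esub> f\<^sub>2 = t \<cdot>\<^bsub>C\<^esub> g\<^sub>2\<rbrakk>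
      \<Longrightarrow> \<exists>!h. h \<in> hom C (Cod C q) T \<and> h \<cdot>\<^bsub>C\<^esub> q = t"
    by (simp_all add: is_joint_coequaliser_def hom_def)
  from q_hom have "Cod C q \<in> Obj C" using cod_in_Obj in_homD by metis
  then obtain r where r: "r \<in> hom C (Cod C s) (Cod C q)" and rs: "r \<cdot>\<^bsub>C\<^esub> s = q"
    using s_univ[OF _ q_hom q_eq(1)] by blast
  note sf\<^sub>2 = comp_in_hom[OF f\<^sub>2 s] and sg\<^sub>2 = comp_in_hom[OF g\<^sub>2 s]
  have "\<exists>!h. h \<in> hom C (Cod C q) T \<and> h \<cdot>\<^bsub>C\<^esub> r = t"
    if T: "T \<in> Obj C" and t: "t \<in> hom C (Cod C s) T"
      and t_eq: "t \<cdot>\<^bsub>C\<^esub> (s \<cdot>\<^bsub>C\<^esub> f\<^sub>2) = t \<cdot>\<^bsub>C\<^esub> (s \<cdot>\<^bsub>C\<^esub> g\<^sub>2)" for T t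
  proof -
    \<comment> \<open>The arrow \<open>t \<cdot> s\<close> is a valid test arrow for
      \<open>q\<close>: it coequalises the first pair because \<open>s\<close> does, and the second
      by \<open>t_eq\<close>.\<close>
    have "\<exists>!h. h \<in> hom C (Cod C q) T \<and> h \<cdot>\<^bsub>C\<^esub> q = t \<cdot>\<^bsub>C\<^esub> s"
      using q_univ[OF T comp_in_hom[OF s t]] s_eq t_eq
      by (simp add: comp_assoc[OF f\<^sub>1 s t] comp_assoc[OF g\<^sub>1 s t]
          comp_assoc[OF f\<^sub>2 s t] comp_assoc[OF g\<^sub>2 s t])
    \<comment> \<open>Factorisations through \<open>q\<close> and through \<open>r\<close> are the
      same arrows \<open>h\<close>: as \<open>q\<close> is \<open>r \<cdot> s\<close>, the
      epimorphism \<open>s\<close> can be cancelled on the right.\<close>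
    moreover have "h \<cdot>\<^bsub>C\<^esub> q = t \<cdot>\<^bsub>C\<^esub> s \<longleftrightarrow> h \<cdot>\<^bsub>C\<^esub> r = t" if h: "h \<in> hom C (Cod C q) T" for h
      using coequaliser_epi[OF coeq \<open>category C\<close> comp_in_hom[OF r h] t]
        comp_assoc[OF s r h] rs by auto
    ultimately show ?thesis by blast
  qed
  moreover have "r \<cdot>\<^bsub>C\<^esub> (s \<cdot>\<^bsub>C\<^esub> f\<^sub>2) = r \<cdot>\<^bsub>C\<^esub> (s \<cdot>\<^bsub>C\<^esub> g\<^sub>2)"
    using comp_assoc[OF f\<^sub>2 s r] comp_assoc[OF g\<^sub>2 s r] rs q_eq by simp
  ultimately have "is_coequaliser C (s \<cdot>\<^bsub>C\<^esub> f\<^sub>2) (s \<cdot>\<^bsub>C\<^esub> g\<^sub>2) r"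
    using in_homD[OF sf\<^sub>2] in_homD[OF sg\<^sub>2] in_homD[OF r] by (simp add: is_coequaliser_def)
  with that r rs show thesis by blast
qed

text \<open>A commutative cocone on the two quotients is the same as one arrow out of the common
  codomain that coequalises both pairs, hence the same as an arrow out of \<open>Cod C q\<close>.
  The legs are regular epimorphisms because each is the coequaliser of the opposite pair pushed
  forward.\<close>

lemma joint_coequaliser_is_pushout:
  assumes "category C"
    and s\<^sub>1: "is_coequaliser C f\<^sub>1 g\<^sub>1 s\<^sub>1" and s\<^sub>2: "is_coequaliser C f\<^sub>2 g\<^sub>2 s\<^sub>2"
    and cod: "Cod C f\<^sub>1 = Cod C f\<^sub>2"
    and q: "is_joint_coequaliser C f\<^sub>1 g\<^sub>1 f\<^sub>2 g\<^sub>2 q"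
  shows "\<exists>q\<^sub>1 \<in> hom C (Cod C s\<^sub>1) (Cod C q). \<exists>q\<^sub>2 \<in> hom C (Cod C s\<^sub>2) (Cod C q).
    regular_epi C q\<^sub>1 \<and> regular_epi C q\<^sub>2 \<and> q\<^sub>1 \<cdot>\<^bsub>C\<^esub> s\<^sub>1 = q \<and> q = q\<^sub>2 \<cdot>\<^bsub>C\<^esub> s\<^sub>2 \<and>
    is_pushout C s\<^sub>1 s\<^sub>2 q\<^sub>1 q\<^sub>2"
proof -
  interpret category C by fact
  let ?X = "Cod C f\<^sub>1"
  from s\<^sub>1 have f\<^sub>1: "f\<^sub>1 \<in> hom C (Dom C f\<^sub>1) ?X" and g\<^sub>1: "g\<^sub>1 \<in> hom C (Dom C f\<^sub>1) ?X"
    and s\<^sub>1_hom: "s\<^sub>1 \<in> hom C ?X (Cod C s\<^sub>1)" and s\<^sub>1_eq: "s\<^sub>1 \<cdot>\<^bsub>C\<^esub> f\<^sub>1 = s\<^sub>1 \<cdot>\<^bsub>C\<^esub> g\<^sub>1"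
    by (simp_all add: is_coequaliser_def hom_def)
  from s\<^sub>2 cod have f\<^sub>2: "f\<^sub>2 \<in> hom C (Dom C f\<^sub>2) ?X" and g\<^sub>2: "g\<^sub>2 \<in> hom C (Dom C f\<^sub>2) ?X"
    and s\<^sub>2_hom: "s\<^sub>2 \<in> hom C ?X (Cod C s\<^sub>2)" and s\<^sub>2_eq: "s\<^sub>2 \<cdot>\<^bsub>C\<^esub> f\<^sub>2 = s\<^sub>2 \<cdot>\<^bsub>C\<^esub> g\<^sub>2"
    by (simp_all add: is_coequaliser_def hom_def)
  obtain q\<^sub>1 where q\<^sub>1: "q\<^sub>1 \<in> hom C (Cod C s\<^sub>1) (Cod C q)" "q\<^sub>1 \<cdot>\<^bsub>C\<^esub> s\<^sub>1 = q"
    and q\<^sub>1_coeq: "is_coequaliser C (s\<^sub>1 \<cdot>\<^bsub>C\<^esub> f\<^sub>2) (s\<^sub>1 \<cdot>\<^bsub>C\<^esub> g\<^sub>2) q\<^sub>1"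
    using joint_coequaliser_factor[OF \<open>category C\<close> s\<^sub>1 f\<^sub>2 g\<^sub>2 q] .
  obtain q\<^sub>2 where q\<^sub>2: "q\<^sub>2 \<in> hom C (Cod C s\<^sub>2) (Cod C q)" "q\<^sub>2 \<cdot>\<^bsub>C\<^esub> s\<^sub>2 = q"
    and q\<^sub>2_coeq: "is_coequaliser C (s\<^sub>2 \<cdot>\<^bsub>C\<^esub> f\<^sub>1) (s\<^sub>2 \<cdot>\<^bsub>C\<^esub> g\<^sub>1) q\<^sub>2"
    using joint_coequaliser_factor[OF \<open>category C\<close> s\<^sub>2 _ _ is_joint_coequaliser_swap[OF q cod]]
      f\<^sub>1 g\<^sub>1 cod by metis
  have "\<exists>!h. h \<in> hom C (Cod C q) T \<and> h \<cdot>\<^bsub>C\<^esub> q\<^sub>1 = a \<and> h \<cdot>\<^bsub>C\<^esub> q\<^sub>2 = b"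
    if T: "T \<in> Obj C" and a: "a \<in> hom C (Cod C s\<^sub>1) T" and b: "b \<in> hom C (Cod C s\<^sub>2) T"
      and ab: "a \<cdot>\<^bsub>C\<^esub> s\<^sub>1 = b \<cdot>\<^bsub>C\<^esub> s\<^sub>2" for T a b
  proof -
    note t = comp_in_hom[OF s\<^sub>1_hom a]
    have t\<^sub>1: "(a \<cdot>\<^bsub>C\<^esub> s\<^sub>1) \<cdot>\<^bsub>C\<^esub> f\<^sub>1 = (a \<cdot>\<^bsub>C\<^esub> s\<^sub>1) \<cdot>\<^bsub>C\<^esub> g\<^sub>1"
      by (simp add: comp_assoc[OF f\<^sub>1 s\<^sub>1_hom a] comp_assoc[OF g\<^sub>1 s\<^sub>1_hom a] s\<^sub>1_eq)
    \<comment> \<open>The quotient \<open>s\<^sub>1\<close> says nothing about the second pair, so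
      the diagonal of the cocone is rewritten as \<open>b \<cdot> s\<^sub>2\<close>.\<close>
    have t\<^sub>2: "(a \<cdot>\<^bsub>C\<^esub> s\<^sub>1) \<cdot>\<^bsub>C\<^esub> f\<^sub>2 = (a \<cdot>\<^bsub>C\<^esub> s\<^sub>1) \<cdot>\<^bsub>C\<^esub> g\<^sub>2"
      unfolding ab
      by (simp add: comp_assoc[OF f\<^sub>2 s\<^sub>2_hom b] comp_assoc[OF g\<^sub>2 s\<^sub>2_hom b] s\<^sub>2_eq)
    from q T t t\<^sub>1 t\<^sub>2 have "\<exists>!h. h \<in> hom C (Cod C q) T \<and> h \<cdot>\<^bsub>C\<^esub> q = a \<cdot>\<^bsub>C\<^esub> s\<^sub>1"
      by (simp add: is_joint_coequaliser_def)
    \<comment> \<open>One equation on the diagonal is worth both triangle equations, since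
      \<open>s\<^sub>1\<close> and \<open>s\<^sub>2\<close> are epimorphisms.\<close>
    moreover have "h \<cdot>\<^bsub>C\<^esub> q = a \<cdot>\<^bsub>C\<^esub> s\<^sub>1 \<longleftrightarrow> h \<cdot>\<^bsub>C\<^esub> q\<^sub>1 = a \<and> h \<cdot>\<^bsub>C\<^esub> q\<^sub>2 = b"
      if h: "h \<in> hom C (Cod C q) T" for h
      using coequaliser_epi[OF s\<^sub>1 \<open>category C\<close> comp_in_hom[OF q\<^sub>1(1) h] a]
        coequaliser_epi[OF s\<^sub>2 \<open>category C\<close> comp_in_hom[OF q\<^sub>2(1) h] b]
        comp_assoc[OF s\<^sub>1_hom q\<^sub>1(1) h] comp_assoc[OF s\<^sub>2_hom q\<^sub>2(1) h] q\<^sub>1(2) q\<^sub>2(2) ab by metis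
    ultimately show ?thesis by blast
  qed
  then have "is_pushout C s\<^sub>1 s\<^sub>2 q\<^sub>1 q\<^sub>2"
    using in_homD[OF s\<^sub>1_hom] in_homD[OF s\<^sub>2_hom] in_homD[OF q\<^sub>1(1)] in_homD[OF q\<^sub>2(1)] q\<^sub>1(2) q\<^sub>2(2)
    by (simp add: is_pushout_def)
  moreover have "regular_epi C q\<^sub>1" "regular_epi C q\<^sub>2"
    using q\<^sub>1_coeq q\<^sub>2_coeq unfolding regular_epi_def by blast+
  ultimately show ?thesis
    using q\<^sub>1(2) q\<^sub>2(2) by (intro bexI[OF _ q\<^sub>1(1)] bexI[OF _ q\<^sub>2(1)]) simp
qed

text \<open>With \<open>u\<close> and \<open>t\<close> mutually inverse, \<open>a\<close> is a test
  arrow for the transported pair exactly when \<open>a \<cdot> u\<close> is one for the original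
  pair, and both have the same factorisations. This moves a quotient of \<open>N + M\<close> to one
  of \<open>M + N\<close>.\<close>

lemma coequaliser_transport_iso:
  assumes "category C" and coeq: "is_coequaliser C f g e"
    and t: "t \<in> hom C Y (Cod C f)" and u: "u \<in> hom C (Cod C f) Y"
    and tu: "t \<cdot>\<^bsub>C\<^esub> u = Ident C (Cod C f)" and ut: "u \<cdot>\<^bsub>C\<^esub> t = Ident C Y"
  shows "is_coequaliser C (u \<cdot>\<^bsub>C\<^esub> f) (u \<cdot>\<^bsub>C\<^esub> g) (e \<cdot>\<^bsub>C\<^esub> t)"
proof -
  interpret category C by fact
  let ?X = "Cod C f"
  from coeq have f: "f \<in> hom C (Dom C f) ?X" and g: "g \<in> hom C (Dom C f) ?X"
    and e: "e \<in> hom C ?X (Cod C e)" and eq: "e \<cdot>\<^bsub>C\<^esub> f = e \<cdot>\<^bsub>C\<^esub> g"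
    by (simp_all add: is_coequaliser_def hom_def)
  note uf = comp_in_hom[OF f u] and ug = comp_in_hom[OF g u] and et = comp_in_hom[OF t e]
  have cancel: "(e \<cdot>\<^bsub>C\<^esub> t) \<cdot>\<^bsub>C\<^esub> u = e"
    by (simp add: comp_assoc[OF u t e] tu comp_ident_right[OF e])
  have "(e \<cdot>\<^bsub>C\<^esub> t) \<cdot>\<^bsub>C\<^esub> (u \<cdot>\<^bsub>C\<^esub> f) = (e \<cdot>\<^bsub>C\<^esub> t) \<cdot>\<^bsub>C\<^esub> (u \<cdot>\<^bsub>C\<^esub> g)"
    using comp_assoc[OF f u et] comp_assoc[OF g u et] eq cancel by simp
  moreover have "\<exists>!h. h \<in> hom C (Cod C e) T \<and> h \<cdot>\<^bsub>C\<^esub> (e \<cdot>\<^bsub>C\<^esub> t) = a"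
    if T: "T \<in> Obj C" and a: "a \<in> hom C Y T"
      and a_eq: "a \<cdot>\<^bsub>C\<^esub> (u \<cdot>\<^bsub>C\<^esub> f) = a \<cdot>\<^bsub>C\<^esub> (u \<cdot>\<^bsub>C\<^esub> g)" for T a
  proof -
    from a_eq have "(a \<cdot>\<^bsub>C\<^esub> u) \<cdot>\<^bsub>C\<^esub> f = (a \<cdot>\<^bsub>C\<^esub> u) \<cdot>\<^bsub>C\<^esub> g"
      by (simp add: comp_assoc[OF f u a] comp_assoc[OF g u a])
    with coeq T comp_in_hom[OF u a]
    have "\<exists>!h. h \<in> hom C (Cod C e) T \<and> h \<cdot>\<^bsub>C\<^esub> e = a \<cdot>\<^bsub>C\<^esub> u"
      by (simp add: is_coequaliser_def)
    moreover have "h \<cdot>\<^bsub>C\<^esub> e = a \<cdot>\<^bsub>C\<^esub> u \<longleftrightarrow> h \<cdot>\<^bsub>C\<^esub> (e \<cdot>\<^bsub>C\<^esub> t) = a" if h: "h \<in> hom C (Cod C e) T" for h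
    proof
      assume "h \<cdot>\<^bsub>C\<^esub> e = a \<cdot>\<^bsub>C\<^esub> u"
      then show "h \<cdot>\<^bsub>C\<^esub> (e \<cdot>\<^bsub>C\<^esub> t) = a"
        using comp_assoc[OF t e h] comp_assoc[OF t u a] ut comp_ident_right[OF a] by simp
    next
      assume "h \<cdot>\<^bsub>C\<^esub> (e \<cdot>\<^bsub>C\<^esub> t) = a"
      then show "h \<cdot>\<^bsub>C\<^esub> e = a \<cdot>\<^bsub>C\<^esub> u"
        using comp_assoc[OF u et h] cancel by simp
    qed
    ultimately show ?thesis by blast
  qed
  ultimately show ?thesis
    using in_homD[OF uf] in_homD[OF ug] in_homD[OF et] by (simp add: is_coequaliser_def)
qed

section \<open>Copairing and the twist for chosen binary coproducts\<close>

locale category_with_coproducts = category C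
  for C :: "('o, 'm, 'z) chosen_cat_scheme" (structure) +
  assumes coproducts: "\<lbrakk>A \<in> Obj C; B \<in> Obj C\<rbrakk> \<Longrightarrow>
    is_coproduct C (inc1 C A B) (inc2 C A B) \<and> Dom C (inc1 C A B) = A \<and> Dom C (inc2 C A B) = B"
begin

lemma inc_in_hom:
  assumes "A \<in> Obj C" "B \<in> Obj C"
  shows "inc1 C A B \<in> hom C A (coprod C A B)" "inc2 C A B \<in> hom C B (coprod C A B)"
  using coproducts[OF assms] by (simp_all add: is_coproduct_def coprod_def hom_def)

lemma coprod_in_Obj: "\<lbrakk>A \<in> Obj C; B \<in> Obj C\<rbrakk> \<Longrightarrow> coprod C A B \<in> Obj C"
  using inc_in_hom(1) cod_in_Obj in_homD by metis

lemma coprod_ex1: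
  assumes f: "f \<in> hom C A X" and g: "g \<in> hom C B X"
  shows "\<exists>!h. h \<in> hom C (coprod C A B) X \<and> h \<cdot> inc1 C A B = f \<and> h \<cdot> inc2 C A B = g"
proof -
  have "A \<in> Obj C" "B \<in> Obj C" "X \<in> Obj C"
    using in_homD[OF f] in_homD[OF g] dom_in_Obj cod_in_Obj by blast+
  with coproducts f g show ?thesis unfolding is_coproduct_def coprod_def by metis
qed

lemma coprod_ext:
  assumes "A \<in> Obj C" "B \<in> Obj C" and h: "h \<in> hom C (coprod C A B) X"
    and h': "h' \<in> hom C (coprod C A B) X"
    and "h \<cdot> inc1 C A B = h' \<cdot> inc1 C A B" "h \<cdot> inc2 C A B = h' \<cdot> inc2 C A B"
  shows "h = h'"
  using coprod_ex1[OF comp_in_hom[OF inc_in_hom(1) h] comp_in_hom[OF inc_in_hom(2) h]] assms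
  by metis

lemma copair:
  assumes "f \<in> hom C A X" "g \<in> hom C B X"
  shows "copair C f g \<in> hom C (coprod C A B) X"
    "copair C f g \<cdot> inc1 C A B = f" "copair C f g \<cdot> inc2 C A B = g"
  using theI'[OF coprod_ex1[OF assms]] in_homD[OF assms(1)] in_homD[OF assms(2)]
  by (simp_all add: copair_def)

text \<open>The inclusions of a coproduct are jointly epic, so an equation between arrows out of it
  can be tested on each summand. This is what splits the single Peiffer pair into two pairs.\<close>

lemma comp_copair_eq_iff:
  assumes f\<^sub>1: "f\<^sub>1 \<in> hom C A X" and f\<^sub>2: "f\<^sub>2 \<in> hom C B X"
    and g\<^sub>1: "g\<^sub>1 \<in> hom C A X" and g\<^sub>2: "g\<^sub>2 \<in> hom C B X" and t: "t \<in> hom C X T"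
  shows "t \<cdot> copair C f\<^sub>1 f\<^sub>2 = t \<cdot> copair C g\<^sub>1 g\<^sub>2 \<longleftrightarrow> t \<cdot> f\<^sub>1 = t \<cdot> g\<^sub>1 \<and> t \<cdot> f\<^sub>2 = t \<cdot> g\<^sub>2"
proof -
  have A: "A \<in> Obj C" and B: "B \<in> Obj C"
    using in_homD[OF f\<^sub>1] in_homD[OF f\<^sub>2] dom_in_Obj by blast+
  note i = inc_in_hom(1)[OF A B] and j = inc_in_hom(2)[OF A B]
  note cf = copair[OF f\<^sub>1 f\<^sub>2] and cg = copair[OF g\<^sub>1 g\<^sub>2]
  have "(t \<cdot> copair C f\<^sub>1 f\<^sub>2) \<cdot> inc1 C A B = t \<cdot> f\<^sub>1" "(t \<cdot> copair C f\<^sub>1 f\<^sub>2) \<cdot> inc2 C A B = t \<cdot> f\<^sub>2"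
    "(t \<cdot> copair C g\<^sub>1 g\<^sub>2) \<cdot> inc1 C A B = t \<cdot> g\<^sub>1" "(t \<cdot> copair C g\<^sub>1 g\<^sub>2) \<cdot> inc2 C A B = t \<cdot> g\<^sub>2"
    using comp_assoc[OF i cf(1) t] comp_assoc[OF j cf(1) t]
      comp_assoc[OF i cg(1) t] comp_assoc[OF j cg(1) t] cf(2,3) cg(2,3) by simp_all
  then show ?thesis
    using coprod_ext[OF A B comp_in_hom[OF cf(1) t] comp_in_hom[OF cg(1) t]] by metis
qed

lemma joint_coequaliser_of_copair:
  assumes f\<^sub>1: "f\<^sub>1 \<in> hom C A X" and f\<^sub>2: "f\<^sub>2 \<in> hom C B X"
    and g\<^sub>1: "g\<^sub>1 \<in> hom C A X" and g\<^sub>2: "g\<^sub>2 \<in> hom C B X"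
    and coeq: "is_coequaliser C (copair C f\<^sub>1 f\<^sub>2) (copair C g\<^sub>1 g\<^sub>2) q"
  shows "is_joint_coequaliser C f\<^sub>1 g\<^sub>1 f\<^sub>2 g\<^sub>2 q"
proof -
  note iff = comp_copair_eq_iff[OF f\<^sub>1 f\<^sub>2 g\<^sub>1 g\<^sub>2]
  have cod: "Cod C (copair C f\<^sub>1 f\<^sub>2) = X" using in_homD[OF copair(1)[OF f\<^sub>1 f\<^sub>2]] by simp
  have "q \<in> hom C X (Cod C q)" using coeq cod by (simp add: is_coequaliser_def hom_def)
  then show ?thesis
    using coeq cod in_homD[OF f\<^sub>1] iff
    unfolding is_coequaliser_def is_joint_coequaliser_def by simp
qed

lemma twist:
  assumes "A \<in> Obj C" "B \<in> Obj C"
  shows "twist C A B \<in> hom C (coprod C A B) (coprod C B A)"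
    "twist C A B \<cdot> inc1 C A B = inc2 C B A" "twist C A B \<cdot> inc2 C A B = inc1 C B A"
  using copair[OF inc_in_hom(2,1)[OF assms(2,1)]] by (simp_all add: twist_def)

text \<open>Two twists send each inclusion to itself, as the identity does.\<close>

lemma twist_twist:
  assumes A: "A \<in> Obj C" and B: "B \<in> Obj C"
  shows "twist C B A \<cdot> twist C A B = Ident C (coprod C A B)"
proof (rule coprod_ext[OF A B])
  note t = twist[OF A B] and u = twist[OF B A]
  note i = inc_in_hom(1)[OF A B] and j = inc_in_hom(2)[OF A B]
  show "twist C B A \<cdot> twist C A B \<in> hom C (coprod C A B) (coprod C A B)"
    using comp_in_hom[OF t(1) u(1)] .
  show "Ident C (coprod C A B) \<in> hom C (coprod C A B) (coprod C A B)"
    using ident_in_hom coprod_in_Obj[OF A B] by blast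
  show "(twist C B A \<cdot> twist C A B) \<cdot> inc1 C A B = Ident C (coprod C A B) \<cdot> inc1 C A B"
    using comp_assoc[OF i t(1) u(1)] t u comp_ident_left[OF i] by simp
  show "(twist C B A \<cdot> twist C A B) \<cdot> inc2 C A B = Ident C (coprod C A B) \<cdot> inc2 C A B"
    using comp_assoc[OF j t(1) u(1)] t u comp_ident_left[OF j] by simp
qed

end

theorem proposition3p5:
  fixes C :: "('o, 'm) chosen_cat" (structure)
    and M N :: 'o
    and \<xi>MN \<xi>NM q \<sigma>NM \<sigma>MN :: 'm
  assumes "semi_abelian_category C"
    and "smith_is_huq C"
    and "chosen_coproducts_kernels C"
    and "internal_action C M N \<xi>MN"
    and "internal_action C N M \<xi>NM"
    and "is_peiffer_quotient C M N \<xi>MN \<xi>NM q"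
    and "is_semidirect_quotient C N M \<xi>NM \<sigma>NM"
    and "is_semidirect_quotient C M N \<xi>MN \<sigma>MN"
  shows "\<exists>q1 \<in> hom C (Cod C \<sigma>NM) (Cod C q). \<exists>q2 \<in> hom C (Cod C \<sigma>MN) (Cod C q).
    regular_epi C q1 \<and> regular_epi C q2 \<and>
    q1 \<cdot> (\<sigma>NM \<cdot> twist C M N) = q \<and> q = q2 \<cdot> \<sigma>MN \<and>
    is_pushout C (\<sigma>NM \<cdot> twist C M N) \<sigma>MN q1 q2"
proof -
  interpret semi_abelian_category C by fact
  interpret category_with_coproducts C
    using assms(3) by unfold_locales (simp add: chosen_coproducts_kernels_def)
  from assms(4,5) have M: "M \<in> Obj C" and N: "N \<in> Obj C"
    and \<alpha>: "\<xi>MN \<in> hom C (flat C M N) N" and \<beta>: "\<xi>NM \<in> hom C (flat C N M) M"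
    by (simp_all add: internal_action_def)
  note t = twist[OF M N] and u = twist[OF N M]
  note ia = comp_in_hom[OF \<alpha> inc_in_hom(2)[OF M N]]
    and ib = comp_in_hom[OF \<beta> inc_in_hom(2)[OF N M]]
    and ib' = comp_in_hom[OF \<beta> inc_in_hom(1)[OF M N]]
  from assms(8) have coeqMN: "is_coequaliser C (inc2 C M N \<cdot> \<xi>MN) (flat_ker C M N) \<sigma>MN"
    by (simp add: is_semidirect_quotient_def)
  from assms(7) have coeqNM: "is_coequaliser C (inc2 C N M \<cdot> \<xi>NM) (flat_ker C N M) \<sigma>NM"
    by (simp add: is_semidirect_quotient_def)
  \<comment> \<open>The types of the kernel arrows are read off from the coequaliser hypotheses:
    each is parallel to an arrow whose type is known from the action.\<close>
  from coeqMN have kMN: "flat_ker C M N \<in> hom C (flat C M N) (coprod C M N)"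
    using in_homD[OF ia] by (simp add: is_coequaliser_def hom_def)
  from coeqNM have kNM: "flat_ker C N M \<in> hom C (flat C N M) (coprod C N M)"
    and \<sigma>: "\<sigma>NM \<in> hom C (coprod C N M) (Cod C \<sigma>NM)"
    using in_homD[OF ib] by (simp_all add: is_coequaliser_def hom_def)
  \<comment> \<open>The quotient \<open>\<sigma>NM\<close> starts at \<open>N + M\<close>, while
    \<open>q\<close> and \<open>\<sigma>MN\<close> start at \<open>M + N\<close>. Transport along
    the twist puts all three on \<open>M + N\<close>.\<close>
  have "is_coequaliser C (twist C N M \<cdot> (inc2 C N M \<cdot> \<xi>NM)) (twist C N M \<cdot> flat_ker C N M)
      (\<sigma>NM \<cdot> twist C M N)"
    using coequaliser_transport_iso[OF category_axioms coeqNM] t(1) u(1)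
      twist_twist[OF M N] twist_twist[OF N M] in_homD[OF ib] by simp
  moreover have "twist C N M \<cdot> (inc2 C N M \<cdot> \<xi>NM) = inc1 C M N \<cdot> \<xi>NM"
    using comp_assoc[OF \<beta> inc_in_hom(2)[OF N M] u(1)] u(3) by simp
  ultimately have coeqNM':
    "is_coequaliser C (inc1 C M N \<cdot> \<xi>NM) (twist C N M \<cdot> flat_ker C N M) (\<sigma>NM \<cdot> twist C M N)"
    by simp
  \<comment> \<open>Unfolding \<open>coprod_map\<close> displays the second Peiffer arrow as a
    copairing, whose components are the actions followed by the inclusions into
    \<open>M + N\<close>.\<close>
  have "is_coequaliser C (copair C (twist C N M \<cdot> flat_ker C N M) (flat_ker C M N))
      (copair C (inc1 C M N \<cdot> \<xi>NM) (inc2 C M N \<cdot> \<xi>MN)) q"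
    using assms(6) in_homD[OF \<alpha>] in_homD[OF \<beta>]
    by (simp add: is_peiffer_quotient_def coprod_map_def)
  \<comment> \<open>The Peiffer pair lists the kernels first and the semi-direct pairs list the
    actions first. The two arrows of each pair are therefore exchanged, which leaves the
    coequalising equations equivalent.\<close>
  from joint_coequaliser_of_copair[OF comp_in_hom[OF kNM u(1)] kMN ib' ia this]
  have "is_joint_coequaliser C (inc1 C M N \<cdot> \<xi>NM) (twist C N M \<cdot> flat_ker C N M)
      (inc2 C M N \<cdot> \<xi>MN) (flat_ker C M N) q"
    using in_homD[OF comp_in_hom[OF kNM u(1)]] in_homD[OF ib']
    unfolding is_joint_coequaliser_def by metis
  from joint_coequaliser_is_pushout[OF category_axioms coeqNM' coeqMN _ this]
  show ?thesis
    using in_homD[OF comp_in_hom[OF t(1) \<sigma>]] in_homD[OF ib'] in_homD[OF ia] by simp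
qed

end
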